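(* Let $K$ be a commutative ring with identity, let $A$ be a $K$-algebra with augmentation $\varepsilon:A\to K$ (a $K$-algebra epimorphism), and let $n\ge 0$. If $A$ is weak bi-$FP_n$, then $A$ is both left-$FP_n$ and right-$FP_n$.
   Context: A module is of type $FP_n$ if there is an exact sequence $0\leftarrow M\leftarrow P_0\leftarrow\cdots\leftarrow P_n$ with $P_0,\dots,P_n$ finitely generated free modules. $A$ is left-$FP_n$ (resp. right-$FP_n$) if $K$, regarded as a left (resp. right) $A$-module via $\varepsilon$, is of type $FP_n$. An $(A,A)$-bimodule is an abelian group $M$ with left and right $A$-actions satisfying $(am)b=a(mb)$ and $km=mk$ for $k\in K$; the free bimodule of rank $r$ is a direct sum of $r$ copies of $A\otimes_K A$ with action $a(u\otimes v)b=au\otimes vb$. $A$ is weak bi-$FP_n$ if $K$, regarded as an $(A,A)$-bimodule via $a\cdot k\cdot a'=\varepsilon(a)k\varepsilon(a')$, has an exact sequence $0\leftarrow K\leftarrow F_0\leftarrow\cdots\leftarrow F_n$ with $F_0,\dots,F_n$ finitely generated free $(A,A)$-bimodules. *)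

theory Defs
  imports Main
begin

text \<open>K is the commutative ring 'k; A is the ring 'a; phi : K -> A is the structure map
  (a unital ring homomorphism with central image); eps : A -> K is the augmentation,
  a K-algebra homomorphism (hence automatically an epimorphism, eps o phi = id).\<close>

definition aug_alg :: "('k::comm_ring_1 \<Rightarrow> 'a::ring_1) \<Rightarrow> ('a \<Rightarrow> 'k) \<Rightarrow> bool" where
  "aug_alg \<phi> \<epsilon> \<longleftrightarrow>
     \<phi> 1 = 1 \<and> (\<forall>x y. \<phi> (x + y) = \<phi> x + \<phi> y) \<and> (\<forall>x y. \<phi> (x * y) = \<phi> x * \<phi> y) \<and>
     (\<forall>k a. \<phi> k * a = a * \<phi> k) \<and>
     \<epsilon> 1 = 1 \<and> (\<forall>a b. \<epsilon> (a + b) = \<epsilon> a + \<epsilon> b) \<and> (\<forall>a b. \<epsilon> (a * b) = \<epsilon> a * \<epsilon> b) \<and>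
     (\<forall>k. \<epsilon> (\<phi> k) = k) \<and> surj \<epsilon>"

text \<open>The free (left or right) A-module of rank r is modelled as the vectors
  nat => 'a vanishing from index r on.\<close>

definition fvec :: "nat \<Rightarrow> (nat \<Rightarrow> 'a::zero) set" where
  "fvec r = {v. \<forall>j\<ge>r. v j = 0}"

definition lin_map ::
  "('a::ring_1 \<Rightarrow> (nat \<Rightarrow> 'a) \<Rightarrow> (nat \<Rightarrow> 'a)) \<Rightarrow> nat \<Rightarrow> nat \<Rightarrow> ((nat \<Rightarrow> 'a) \<Rightarrow> (nat \<Rightarrow> 'a)) \<Rightarrow> bool" where
  "lin_map act r s f \<longleftrightarrow>
     (\<forall>v\<in>fvec r. f v \<in> fvec s) \<and>
     (\<forall>v\<in>fvec r. \<forall>w\<in>fvec r. f (\<lambda>j. v j + w j) = (\<lambda>j. f v j + f w j)) \<and>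
     (\<forall>a. \<forall>v\<in>fvec r. f (act a v) = act a (f v))"

definition FP_free ::
  "('a::ring_1 \<Rightarrow> (nat \<Rightarrow> 'a) \<Rightarrow> (nat \<Rightarrow> 'a)) \<Rightarrow> ('a \<Rightarrow> 'k::comm_ring_1 \<Rightarrow> 'k) \<Rightarrow> nat \<Rightarrow> bool" where
  "FP_free act actK n \<longleftrightarrow>
    (\<exists>(r :: nat \<Rightarrow> nat) (d0 :: (nat \<Rightarrow> 'a) \<Rightarrow> 'k)
       (d :: nat \<Rightarrow> (nat \<Rightarrow> 'a) \<Rightarrow> (nat \<Rightarrow> 'a)).
      (\<forall>v\<in>fvec (r 0). \<forall>w\<in>fvec (r 0). d0 (\<lambda>j. v j + w j) = d0 v + d0 w) \<and>
      (\<forall>a. \<forall>v\<in>fvec (r 0). d0 (act a v) = actK a (d0 v)) \<and>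
      d0 ` fvec (r 0) = UNIV \<and>
      (\<forall>i\<in>{1..n}. lin_map act (r i) (r (i - 1)) (d i)) \<and>
      (1 \<le> n \<longrightarrow> (\<forall>v\<in>fvec (r 0). d0 v = 0 \<longleftrightarrow> (\<exists>w\<in>fvec (r 1). d 1 w = v))) \<and>
      (\<forall>i\<in>{1..<n}. \<forall>v\<in>fvec (r i). d i v = (\<lambda>j. 0) \<longleftrightarrow> (\<exists>w\<in>fvec (r (i + 1)). d (i + 1) w = v)))"

definition left_FP :: "('a::ring_1 \<Rightarrow> 'k::comm_ring_1) \<Rightarrow> nat \<Rightarrow> bool" where
  "left_FP \<epsilon> n = FP_free (\<lambda>a v j. a * v j) (\<lambda>a k. \<epsilon> a * k) n"

definition right_FP :: "('a::ring_1 \<Rightarrow> 'k::comm_ring_1) \<Rightarrow> nat \<Rightarrow> bool" where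
  "right_FP \<epsilon> n = FP_free (\<lambda>a v j. v j * a) (\<lambda>a k. k * \<epsilon> a) n"

text \<open>An element of the free bimodule of rank r is represented by a list of triples
  (i, u, v) with i < r, standing for the sum of the elements u \<otimes> v placed in
  component i. The equivalence tensor_eq is the congruence presenting
  the direct sum of copies of A \<otimes>_K A (a commutative monoid in which every
  generator has an inverse, (i,u,v)+(i,-u,v) ~ (i,0,v) ~ 0, hence an abelian group;
  biadditive and K-balanced).\<close>

inductive tensor_eq :: "('k::comm_ring_1 \<Rightarrow> 'a::ring_1) \<Rightarrow> (nat \<times> 'a \<times> 'a) list \<Rightarrow> (nat \<times> 'a \<times> 'a) list \<Rightarrow> bool"
  for \<phi> where
  te_refl: "tensor_eq \<phi> xs xs"
| te_sym: "tensor_eq \<phi> xs ys \<Longrightarrow> tensor_eq \<phi> ys xs"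
| te_trans: "tensor_eq \<phi> xs ys \<Longrightarrow> tensor_eq \<phi> ys zs \<Longrightarrow> tensor_eq \<phi> xs zs"
| te_app: "tensor_eq \<phi> xs ys \<Longrightarrow> tensor_eq \<phi> zs ws \<Longrightarrow> tensor_eq \<phi> (xs @ zs) (ys @ ws)"
| te_comm: "tensor_eq \<phi> (xs @ ys) (ys @ xs)"
| te_addl: "tensor_eq \<phi> [(i, u + u', v)] [(i, u, v), (i, u', v)]"
| te_addr: "tensor_eq \<phi> [(i, u, v + v')] [(i, u, v), (i, u, v')]"
| te_zero: "tensor_eq \<phi> [(i, 0, v)] []"
| te_bal: "tensor_eq \<phi> [(i, \<phi> k * u, v)] [(i, u, \<phi> k * v)]"

definition bvec :: "nat \<Rightarrow> (nat \<times> 'a \<times> 'a) list set" where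
  "bvec r = {xs. \<forall>(i, u, v) \<in> set xs. i < r}"

definition bact :: "'a::ring_1 \<Rightarrow> 'a \<Rightarrow> (nat \<times> 'a \<times> 'a) list \<Rightarrow> (nat \<times> 'a \<times> 'a) list" where
  "bact a b xs = map (\<lambda>(i, u, v). (i, a * u, v * b)) xs"

definition bhom :: "('k::comm_ring_1 \<Rightarrow> 'a::ring_1) \<Rightarrow> nat \<Rightarrow> nat
    \<Rightarrow> ((nat \<times> 'a \<times> 'a) list \<Rightarrow> (nat \<times> 'a \<times> 'a) list) \<Rightarrow> bool" where
  "bhom \<phi> r s f \<longleftrightarrow>
     (\<forall>xs\<in>bvec r. f xs \<in> bvec s) \<and>
     (\<forall>xs\<in>bvec r. \<forall>ys\<in>bvec r. tensor_eq \<phi> xs ys \<longrightarrow> tensor_eq \<phi> (f xs) (f ys)) \<and>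
     (\<forall>xs\<in>bvec r. \<forall>ys\<in>bvec r. tensor_eq \<phi> (f (xs @ ys)) (f xs @ f ys)) \<and>
     (\<forall>a b. \<forall>xs\<in>bvec r. tensor_eq \<phi> (f (bact a b xs)) (bact a b (f xs)))"

definition weak_bi_FP :: "('k::comm_ring_1 \<Rightarrow> 'a::ring_1) \<Rightarrow> ('a \<Rightarrow> 'k) \<Rightarrow> nat \<Rightarrow> bool" where
  "weak_bi_FP \<phi> \<epsilon> n \<longleftrightarrow>
    (\<exists>(r :: nat \<Rightarrow> nat) (g :: (nat \<times> 'a \<times> 'a) list \<Rightarrow> 'k)
       (d :: nat \<Rightarrow> (nat \<times> 'a \<times> 'a) list \<Rightarrow> (nat \<times> 'a \<times> 'a) list).
      (\<forall>xs\<in>bvec (r 0). \<forall>ys\<in>bvec (r 0). tensor_eq \<phi> xs ys \<longrightarrow> g xs = g ys) \<and>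
      (\<forall>xs\<in>bvec (r 0). \<forall>ys\<in>bvec (r 0). g (xs @ ys) = g xs + g ys) \<and>
      (\<forall>a b. \<forall>xs\<in>bvec (r 0). g (bact a b xs) = \<epsilon> a * g xs * \<epsilon> b) \<and>
      g ` bvec (r 0) = UNIV \<and>
      (\<forall>i\<in>{1..n}. bhom \<phi> (r i) (r (i - 1)) (d i)) \<and>
      (1 \<le> n \<longrightarrow> (\<forall>xs\<in>bvec (r 0). g xs = 0 \<longleftrightarrow>
                     (\<exists>ys\<in>bvec (r 1). tensor_eq \<phi> (d 1 ys) xs))) \<and>
      (\<forall>i\<in>{1..<n}. \<forall>xs\<in>bvec (r i). tensor_eq \<phi> (d i xs) [] \<longleftrightarrow>
                     (\<exists>ys\<in>bvec (r (i + 1)). tensor_eq \<phi> (d (i + 1) ys) xs)))"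

end

theory Submission
  imports Defs
begin

text \<open>
  The algebra \<open>A\<close> is a retract of its enveloping algebra \<open>S = A \<otimes> A\<^sup>o\<^sup>p\<close>: the map \<open>a \<mapsto> a \<otimes> 1\<close> is split by
  \<open>\<rho>(u \<otimes> v) = u \<epsilon>(v)\<close>, compatibly with the augmentations (and symmetrically for the right-hand side).
  No flatness over \<open>K\<close> is needed to push a free resolution \<open>(F, d)\<close> of \<open>K\<close> over \<open>S\<close> along the retraction.
  Put \<open>P\<^sub>0 = A\<^bsup>r(0)\<^esup>\<close> and \<open>P\<^sub>m = A\<^bsup>r(m)\<^esup> \<oplus> P\<^bsub>m-1\<^esub>\<close> with differential \<open>D(x, y) = \<rho>(d x) + k y\<close>, where
  \<open>\<alpha> : P\<^sub>m \<rightarrow> F\<^sub>m\<close> is an \<open>A\<close>-linear chain map lifting the identity of \<open>K\<close> (it exists since \<open>P\<^sub>m\<close> is free and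
  \<open>F\<close> exact), \<open>\<rho> : F\<^sub>m \<rightarrow> A\<^bsup>r(m)\<^esup> \<subseteq> P\<^sub>m\<close>, and \<open>k = id - \<rho>\<alpha> - (0, D)\<close> on \<open>P\<^sub>m\<close> (\<open>k = 0\<close> on \<open>P\<^sub>0\<close>).
  Here \<open>y \<mapsto> (0, y)\<close> plays the role of a homotopy between \<open>\<rho>\<alpha>\<close> and \<open>id\<close>, so \<open>k\<close> has values in the cycles, and
  every cycle \<open>z\<close> equals \<open>\<rho>(\<alpha> z) + k z\<close>, hence is a boundary because the cycle \<open>\<alpha> z\<close> is one.
\<close>

section \<open>Lists of elementary tensors\<close>

lemma tensor_eq_middle_swap:
  "tensor_eq \<phi> ((xs @ ys) @ (zs @ ws)) ((xs @ zs) @ (ys @ ws))"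
proof -
  have "tensor_eq \<phi> (xs @ ((ys @ zs) @ ws)) (xs @ ((zs @ ys) @ ws))"
    by (intro te_app te_refl te_comm)
  then show ?thesis by simp
qed

lemma bact_append: "bact a b (xs @ ys) = bact a b xs @ bact a b ys"
  by (simp add: bact_def)

lemma bact_bact: "bact a b (bact c d xs) = bact (a * c) (d * b) xs"
  by (auto simp: bact_def mult.assoc)

lemma bact_one: "bact 1 1 xs = xs"
  by (simp add: bact_def case_prod_unfold)

lemma bact_in_bvec: "xs \<in> bvec r \<Longrightarrow> bact a b xs \<in> bvec r"
  by (force simp: bact_def bvec_def)

lemma append_in_bvec: "xs \<in> bvec r \<Longrightarrow> ys \<in> bvec r \<Longrightarrow> xs @ ys \<in> bvec r"
  by (auto simp: bvec_def)

lemma Nil_in_bvec: "[] \<in> bvec r"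
  by (simp add: bvec_def)

lemma unit_in_bvec: "i < r \<Longrightarrow> [(i, u, v)] \<in> bvec r"
  by (simp add: bvec_def)

text \<open>Centrality enters in the balancing relation, where \<open>\<phi> k\<close> has to move
  past the left factor \<open>a\<close>.\<close>

lemma tensor_eq_bact:
  assumes central: "\<And>k a. \<phi> k * a = a * \<phi> k" and "tensor_eq \<phi> xs ys"
  shows "tensor_eq \<phi> (bact a b xs) (bact a b ys)"
  using assms(2)
proof induction
  case (te_bal i k u v)
  have "a * (\<phi> k * u) = \<phi> k * (a * u)"
    by (metis central mult.assoc)
  then show ?case
    by (simp add: bact_def mult.assoc tensor_eq.te_bal)
qed (auto simp: bact_def distrib_left distrib_right intro: tensor_eq.intros)

lemma tensor_eq_bact_zero: "tensor_eq \<phi> (bact 0 b xs) []"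
proof (induction xs)
  case (Cons t xs)
  obtain i u v where "t = (i, u, v)" by (cases t)
  then show ?case
    using te_app[OF te_zero[of \<phi> i "v * b"] Cons.IH] by (simp add: bact_def)
qed (simp add: bact_def te_refl)

lemma tensor_eq_bact_add_left:
  "tensor_eq \<phi> (bact (a + a') b xs) (bact a b xs @ bact a' b xs)"
proof (induction xs)
  case (Cons t xs)
  obtain i u v where t: "t = (i, u, v)" by (cases t)
  have "tensor_eq \<phi> (bact (a + a') b (t # xs))
    ([(i, a * u, v * b), (i, a' * u, v * b)] @ (bact a b xs @ bact a' b xs))"
    using te_app[OF te_addl[of \<phi> i "a * u" "a' * u" "v * b"] Cons.IH]
    by (simp add: bact_def t distrib_right)
  then show ?case
    using te_trans tensor_eq_middle_swap[of \<phi> "[(i, a * u, v * b)]" "[(i, a' * u, v * b)]"]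
    by (fastforce simp: bact_def t)
qed (simp add: bact_def te_refl)

text \<open>\<open>bact (- 1) 1 xs\<close> is an additive inverse of \<open>xs\<close>, because
  \<open>- 1 + 1\<close> acts as zero, so one copy of \<open>xs\<close> can be cancelled. Hence maps
  that are additive up to \<open>tensor_eq\<close> send the empty list to zero.\<close>

lemma tensor_eq_idem_Nil:
  fixes \<phi> :: "'k::comm_ring_1 \<Rightarrow> 'a::ring_1"
  assumes "tensor_eq \<phi> xs (xs @ xs)"
  shows "tensor_eq \<phi> xs []"
proof -
  let ?neg = "bact (- 1) 1 xs"
  have "tensor_eq \<phi> (bact (- 1 + 1) 1 xs) (?neg @ bact 1 1 xs)"
    by (rule tensor_eq_bact_add_left)
  then have neg: "tensor_eq \<phi> (?neg @ xs) []"
    using tensor_eq_bact_zero[of \<phi> 1 xs] te_sym te_trans by (fastforce simp: bact_one)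
  have "tensor_eq \<phi> (?neg @ xs) ((?neg @ xs) @ xs)"
    using te_app[OF te_refl assms] by simp
  moreover have "tensor_eq \<phi> ((?neg @ xs) @ xs) xs"
    using te_app[OF neg te_refl[of \<phi> xs]] by simp
  ultimately show ?thesis
    using neg te_sym te_trans by blast
qed

lemma bhom_append:
  "bhom \<phi> r s f \<Longrightarrow> xs \<in> bvec r \<Longrightarrow> ys \<in> bvec r \<Longrightarrow> tensor_eq \<phi> (f (xs @ ys)) (f xs @ f ys)"
  by (simp add: bhom_def)

lemma bhom_bact:
  "bhom \<phi> r s f \<Longrightarrow> xs \<in> bvec r \<Longrightarrow> tensor_eq \<phi> (f (bact a b xs)) (bact a b (f xs))"
  by (simp add: bhom_def)

lemma bhom_Nil:
  assumes "bhom \<phi> r s f"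
  shows "tensor_eq \<phi> (f []) []"
  using bhom_append[OF assms Nil_in_bvec Nil_in_bvec] by (simp add: tensor_eq_idem_Nil)

section \<open>The retraction of the enveloping algebra\<close>

text \<open>
  The operation \<open>\<odot>\<close> is the multiplication of \<open>A\<close> or of its opposite; \<open>a \<mapsto> l a \<otimes> r a\<close> is the embedding
  of this ring into the enveloping algebra, and \<open>\<rho>\<close> the retraction.
\<close>

locale enveloping_retract =
  fixes \<phi> :: "'k::comm_ring_1 \<Rightarrow> 'a::ring_1" and \<epsilon> :: "'a \<Rightarrow> 'k"
    and mul :: "'a \<Rightarrow> 'a \<Rightarrow> 'a" (infixl "\<odot>" 70)
    and \<rho> :: "'a \<Rightarrow> 'a \<Rightarrow> 'a" and l r :: "'a \<Rightarrow> 'a"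
  assumes central: "\<phi> k * a = a * \<phi> k"
    and eps_add: "\<epsilon> (a + b) = \<epsilon> a + \<epsilon> b"
    and eps_mul: "\<epsilon> (a \<odot> b) = \<epsilon> a * \<epsilon> b"
    and eps_rho: "\<epsilon> (\<rho> a b) = \<epsilon> a * \<epsilon> b"
    and mul_assoc: "(a \<odot> b) \<odot> c = a \<odot> (b \<odot> c)"
    and mul_add_left: "(a + b) \<odot> c = a \<odot> c + b \<odot> c"
    and mul_add_right: "a \<odot> (b + c) = a \<odot> b + a \<odot> c"
    and mul_one: "a \<odot> 1 = a"
    and rho_add_left: "\<rho> (u + u') v = \<rho> u v + \<rho> u' v"
    and rho_add_right: "\<rho> u (v + v') = \<rho> u v + \<rho> u v'"
    and rho_balanced: "\<rho> (\<phi> k * u) v = \<rho> u (\<phi> k * v)"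
    and rho_mult: "\<rho> (a * u) (v * b) = \<rho> a b \<odot> \<rho> u v"
    and rho_embed: "\<rho> (l a) (r a) = a"
    and embed_one: "l 1 = 1" "r 1 = 1"
    and embed_mul: "l (a \<odot> b) = l a * l b" "r (a \<odot> b) = r b * r a"
    and embed_add: "tensor_eq \<phi> [(i, l (a + b) * u, v * r (a + b))]
                      [(i, l a * u, v * r a), (i, l b * u, v * r b)]"
begin

abbreviation teq (infix "\<approx>" 50) where "xs \<approx> ys \<equiv> tensor_eq \<phi> xs ys"

abbreviation act :: "'a \<Rightarrow> (nat \<Rightarrow> 'a) \<Rightarrow> (nat \<Rightarrow> 'a)" where
  "act a v \<equiv> \<lambda>j. a \<odot> v j"

abbreviation embed_act where "embed_act a xs \<equiv> bact (l a) (r a) xs"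

definition comb :: "nat \<Rightarrow> (nat \<Rightarrow> 'a) \<Rightarrow> (nat \<Rightarrow> nat \<Rightarrow> 'a) \<Rightarrow> nat \<Rightarrow> 'a" where
  "comb p w c = (\<lambda>i. \<Sum>j<p. w j \<odot> c j i)"

text \<open>Linear maps out of a free module are built from prescribed images \<open>c j\<close> of
  the basis vectors: by \<open>comb\<close> into a free module, by \<open>tcomb\<close> into a free
  bimodule seen as a module along the embedding.\<close>

definition tcomb :: "nat \<Rightarrow> (nat \<Rightarrow> 'a) \<Rightarrow> (nat \<Rightarrow> (nat \<times> 'a \<times> 'a) list) \<Rightarrow> (nat \<times> 'a \<times> 'a) list" where
  "tcomb p w c = concat (map (\<lambda>j. embed_act (w j) (c j)) [0..<p])"

text \<open>The base change map from a free bimodule to the free module of the same rank, computed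
  on representatives.\<close>

definition rhov :: "(nat \<times> 'a \<times> 'a) list \<Rightarrow> nat \<Rightarrow> 'a" where
  "rhov xs = (\<lambda>j. \<Sum>(i, u, v)\<leftarrow>xs. if i = j then \<rho> u v else 0)"

definition unitv :: "nat \<Rightarrow> nat \<Rightarrow> 'a" where
  "unitv j = (\<lambda>i. if i = j then 1 else 0)"

lemma mul_zero_left: "0 \<odot> a = 0"
  using mul_add_left[of 0 0 a] by simp

lemma mul_zero_right: "a \<odot> 0 = 0"
  using mul_add_right[of a 0 0] by simp

lemma mul_minus_right: "a \<odot> (b - c) = a \<odot> b - a \<odot> c"
  using mul_add_right[of a "b - c" c] by (simp add: algebra_simps)

lemma mul_sum_right: "a \<odot> (\<Sum>j\<in>J. f j) = (\<Sum>j\<in>J. a \<odot> f j)"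
  by (induction J rule: infinite_finite_induct) (simp_all add: mul_add_right mul_zero_right)

lemma rho_zero_left: "\<rho> 0 v = 0"
  using rho_add_left[of 0 0 v] by simp

lemma rho_one: "\<rho> 1 1 = 1"
  using rho_embed[of 1] by (simp add: embed_one)

lemma eps_zero: "\<epsilon> 0 = 0"
  using eps_add[of 0 0] by simp

section \<open>Linear combinations in free modules\<close>

lemma fvec_add: "v \<in> fvec p \<Longrightarrow> w \<in> fvec p \<Longrightarrow> (\<lambda>j. v j + w j) \<in> fvec p" for v :: "nat \<Rightarrow> 'a"
  by (simp add: fvec_def)

lemma fvec_act: "v \<in> fvec p \<Longrightarrow> act a v \<in> fvec p"
  by (simp add: fvec_def mul_zero_right)

lemma fvec_zero: "(\<lambda>j. 0) \<in> fvec p"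
  by (simp add: fvec_def)

lemma unitv_in_fvec: "j < p \<Longrightarrow> unitv j \<in> fvec p"
  by (auto simp: fvec_def unitv_def)

lemma comb_in_fvec: "(\<And>j. j < p \<Longrightarrow> c j \<in> fvec q) \<Longrightarrow> comb p w c \<in> fvec q"
  by (simp add: comb_def fvec_def mul_zero_right)

lemma comb_0: "comb 0 w c = (\<lambda>i. 0)"
  by (simp add: comb_def)

lemma comb_Suc: "comb (Suc p) w c = (\<lambda>i. comb p w c i + act (w p) (c p) i)"
  by (simp add: comb_def)

lemma comb_add: "comb p (\<lambda>j. v j + w j) c = (\<lambda>i. comb p v c i + comb p w c i)"
  by (simp add: comb_def mul_add_left sum.distrib)

lemma comb_act: "comb p (act a w) c = act a (comb p w c)"
  by (simp add: comb_def mul_assoc mul_sum_right)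

lemma comb_unitv:
  assumes "w \<in> fvec p"
  shows "comb p w unitv = w"
proof
  fix i
  have "comb p w unitv i = (\<Sum>j<p. if i = j then w j else 0)"
    unfolding comb_def unitv_def by (rule sum.cong) (auto simp: mul_one mul_zero_right)
  also have "\<dots> = w i" using assms by (auto simp: fvec_def)
  finally show "comb p w unitv i = w i" .
qed

lemma lin_map_add:
  "lin_map act p q f \<Longrightarrow> v \<in> fvec p \<Longrightarrow> w \<in> fvec p \<Longrightarrow>
    f (\<lambda>j. v j + w j) = (\<lambda>j. f v j + f w j)"
  unfolding lin_map_def by simp

lemma lin_map_act: "lin_map act p q f \<Longrightarrow> v \<in> fvec p \<Longrightarrow> f (act a v) = act a (f v)"
  unfolding lin_map_def by simp

lemma lin_map_zero:
  assumes "lin_map act p q f"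
  shows "f (\<lambda>j. 0) = (\<lambda>j. 0)"
  using lin_map_add[OF assms fvec_zero fvec_zero] by (simp add: fun_eq_iff)

lemma lin_map_comb:
  assumes f: "lin_map act p q f" and "\<And>j. j < t \<Longrightarrow> c j \<in> fvec p"
  shows "f (comb t w c) = comb t w (\<lambda>j. f (c j))"
  using assms(2)
proof (induction t)
  case 0
  then show ?case using lin_map_zero[OF f] by (simp add: comb_0)
next
  case (Suc t)
  then have "comb t w c \<in> fvec p" "c t \<in> fvec p" "act (w t) (c t) \<in> fvec p"
    by (auto intro: comb_in_fvec fvec_act)
  then have "f (\<lambda>i. comb t w c i + act (w t) (c t) i)
      = (\<lambda>i. f (comb t w c) i + act (w t) (f (c t)) i)"
    using lin_map_add[OF f] lin_map_act[OF f] by simp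
  then show ?case using Suc by (simp add: comb_Suc)
qed

section \<open>Linear combinations in free bimodules along the embedding\<close>

lemma embed_act_add: "embed_act (a + b) xs \<approx> embed_act a xs @ embed_act b xs"
proof (induction xs)
  case (Cons t xs)
  obtain i u v where t: "t = (i, u, v)" by (cases t)
  have "embed_act (a + b) (t # xs)
    \<approx> [(i, l a * u, v * r a), (i, l b * u, v * r b)] @ (embed_act a xs @ embed_act b xs)"
    using te_app[OF embed_add[of i a b u v] Cons.IH] by (simp add: bact_def t)
  then show ?case
    using te_trans tensor_eq_middle_swap[of \<phi> "[(i, l a * u, v * r a)]" "[(i, l b * u, v * r b)]"]
    by (fastforce simp: bact_def t)
qed (simp add: bact_def te_refl)

lemma embed_act_mul: "embed_act (a \<odot> b) xs = embed_act a (embed_act b xs)"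
  by (simp add: embed_mul bact_bact)

lemma tcomb_0: "tcomb 0 w c = []"
  by (simp add: tcomb_def)

lemma tcomb_Suc: "tcomb (Suc p) w c = tcomb p w c @ embed_act (w p) (c p)"
  by (simp add: tcomb_def)

lemma tcomb_in_bvec: "(\<And>j. j < p \<Longrightarrow> c j \<in> bvec s) \<Longrightarrow> tcomb p w c \<in> bvec s"
  by (induction p) (simp_all add: tcomb_0 tcomb_Suc Nil_in_bvec append_in_bvec bact_in_bvec)

lemma tcomb_add: "tcomb p (\<lambda>j. v j + w j) c \<approx> tcomb p v c @ tcomb p w c"
proof (induction p)
  case (Suc p)
  show ?case unfolding tcomb_Suc
    by (rule te_trans[OF te_app[OF Suc embed_act_add] tensor_eq_middle_swap])
qed (simp add: tcomb_0 te_refl)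

lemma tcomb_act: "tcomb p (act a w) c = embed_act a (tcomb p w c)"
  by (induction p) (simp_all add: tcomb_0 tcomb_Suc bact_append embed_act_mul, simp add: bact_def)

lemma tcomb_cong: "(\<And>j. j < p \<Longrightarrow> c j \<approx> c' j) \<Longrightarrow> tcomb p w c \<approx> tcomb p w c'"
  by (induction p) (simp_all add: tcomb_0 tcomb_Suc te_refl te_app tensor_eq_bact central)

lemma bhom_tcomb:
  assumes f: "bhom \<phi> s t f" and "\<And>j. j < p \<Longrightarrow> c j \<in> bvec s"
  shows "f (tcomb p w c) \<approx> tcomb p w (\<lambda>j. f (c j))"
  using assms(2)
proof (induction p)
  case 0
  then show ?case using bhom_Nil[OF f] by (simp add: tcomb_0)
next
  case (Suc p)
  have in_bvec: "tcomb p w c \<in> bvec s" "c p \<in> bvec s" "embed_act (w p) (c p) \<in> bvec s"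
    using Suc.prems by (auto intro: tcomb_in_bvec bact_in_bvec)
  then have "f (tcomb p w c @ embed_act (w p) (c p)) \<approx> f (tcomb p w c) @ f (embed_act (w p) (c p))"
    by (intro bhom_append[OF f])
  moreover have "\<dots> \<approx> tcomb p w (\<lambda>j. f (c j)) @ embed_act (w p) (f (c p))"
    using Suc by (intro te_app bhom_bact[OF f] in_bvec) simp
  ultimately show ?case unfolding tcomb_Suc by (rule te_trans)
qed

section \<open>Base change along the retraction\<close>

lemma rhov_Nil: "rhov [] = (\<lambda>j. 0)"
  by (simp add: rhov_def)

lemma rhov_append: "rhov (xs @ ys) = (\<lambda>j. rhov xs j + rhov ys j)"
  by (simp add: rhov_def)

lemma rhov_single: "rhov [(i, u, v)] = act (\<rho> u v) (unitv i)"
  by (auto simp: rhov_def unitv_def mul_one mul_zero_right)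

lemma rhov_unit: "rhov [(i, 1, 1)] = unitv i"
  by (auto simp: rhov_def unitv_def rho_one)

text \<open>By \<open>rho_mult\<close> the retraction is multiplicative on the enveloping algebra,
  so its extension to vectors is semilinear.\<close>

lemma rhov_bact: "rhov (bact a b xs) = act (\<rho> a b) (rhov xs)"
proof
  show "rhov (bact a b xs) j = act (\<rho> a b) (rhov xs) j" for j
    by (induction xs) (auto simp: rhov_def bact_def rho_mult mul_add_right mul_zero_right)
qed

lemma rhov_in_fvec: "xs \<in> bvec s \<Longrightarrow> rhov xs \<in> fvec s"
proof (induction xs)
  case Nil
  then show ?case by (simp add: rhov_Nil fvec_zero)
next
  case (Cons t xs)
  obtain i u v where t: "t = (i, u, v)" by (cases t)
  then have "i < s" "xs \<in> bvec s" using Cons.prems by (auto simp: bvec_def)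
  then show ?case
    using Cons.IH rhov_append[of "[t]" xs] by (auto simp: t rhov_single fvec_def unitv_def mul_zero_right)
qed

text \<open>The retraction respects every defining relation of the tensor product, the balancing one
  by \<open>rho_balanced\<close>. Congruences of lists thus become equalities of vectors.\<close>

lemma rhov_cong: "xs \<approx> ys \<Longrightarrow> rhov xs = rhov ys"
  by (induction rule: tensor_eq.induct)
    (auto simp: rhov_append, auto simp: rhov_def fun_eq_iff rho_add_left rho_add_right rho_zero_left rho_balanced)

lemma rhov_tcomb: "rhov (tcomb p w c) = comb p w (\<lambda>j. rhov (c j))"
  by (induction p) (simp_all add: tcomb_0 tcomb_Suc comb_0 comb_Suc rhov_Nil rhov_append rhov_bact rho_embed)

text \<open>A bimodule map is determined by its values on the generators \<open>[(j, 1, 1)]\<close>,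
  and \<open>rhov\<close> is semilinear, so \<open>rhov (f xs)\<close> depends on
  \<open>rhov xs\<close> only. The vectors \<open>rhov (f [(j, 1, 1)])\<close> form the matrix of
  the base-changed map.\<close>

lemma rhov_bhom:
  assumes f: "bhom \<phi> s t f" and "xs \<in> bvec s"
  shows "rhov (f xs) = comb s (rhov xs) (\<lambda>j. rhov (f [(j, 1, 1)]))"
  using assms(2)
proof (induction xs)
  case Nil
  have "rhov (f []) = (\<lambda>j. 0)" using rhov_cong[OF bhom_Nil[OF f]] by (simp add: rhov_Nil)
  then show ?case by (simp add: rhov_Nil comb_def mul_zero_left)
next
  case (Cons x xs)
  let ?c = "\<lambda>j. rhov (f [(j, 1, 1)])"
  obtain i u v where x: "x = (i, u, v)" by (cases x)
  then have i: "i < s" and xs: "xs \<in> bvec s" using Cons.prems by (auto simp: bvec_def)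
  have bact: "bact u v [(i, 1, 1)] = [x]" by (simp add: bact_def x)
  have "f ([x] @ xs) \<approx> f [x] @ f xs" "f (bact u v [(i, 1, 1)]) \<approx> bact u v (f [(i, 1, 1)])"
    using bhom_append[OF f unit_in_bvec[OF i] xs] bhom_bact[OF f unit_in_bvec[OF i]]
    by (simp_all only: x)
  from this[THEN rhov_cong]
  have "rhov (f (x # xs)) = (\<lambda>j. act (\<rho> u v) (?c i) j + rhov (f xs) j)"
    by (simp add: rhov_append rhov_bact bact)
  moreover have "comb s (rhov [x]) ?c = act (\<rho> u v) (?c i)"
  proof
    fix j
    have "comb s (rhov [x]) ?c j = (\<Sum>h<s. if h = i then \<rho> u v \<odot> ?c i j else 0)"
      unfolding comb_def by (rule sum.cong) (auto simp: x rhov_def mul_zero_left)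
    then show "comb s (rhov [x]) ?c j = act (\<rho> u v) (?c i) j" using i by simp
  qed
  moreover have "rhov (x # xs) = (\<lambda>j. rhov [x] j + rhov xs j)"
    using rhov_append[of "[x]" xs] by simp
  ultimately show ?case using Cons.IH[OF xs] by (simp add: comb_add)
qed

section \<open>One step of the resolution\<close>

text \<open>
  The state of the construction in one degree: \<open>B\<close> are the cycles of the free bimodule of rank \<open>s\<close>,
  \<open>Z\<close> the cycles of the free module of rank \<open>p\<close>.
\<close>

definition splits_cycles where
  "splits_cycles s B p Z \<alpha> k \<longleftrightarrow>
     Z \<subseteq> fvec p \<and> (\<forall>v\<in>Z. \<forall>w\<in>Z. (\<lambda>j. v j + w j) \<in> Z) \<and>
     (\<forall>v\<in>fvec p. \<alpha> v \<in> bvec s) \<and>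
     (\<forall>v\<in>fvec p. \<forall>w\<in>fvec p. \<alpha> (\<lambda>j. v j + w j) \<approx> \<alpha> v @ \<alpha> w) \<and>
     (\<forall>a. \<forall>v\<in>fvec p. \<alpha> (act a v) \<approx> embed_act a (\<alpha> v)) \<and>
     lin_map act p p k \<and> (\<forall>v\<in>fvec p. k v \<in> Z) \<and>
     (\<forall>z\<in>Z. \<alpha> z \<in> B) \<and> (\<forall>xs\<in>B. rhov xs \<in> Z) \<and>
     (\<forall>z\<in>Z. z = (\<lambda>j. rhov (\<alpha> z) j + k z j))"

lemma splits_cycles_alpha_add:
  "splits_cycles s B p Z \<alpha> k \<Longrightarrow> v \<in> fvec p \<Longrightarrow> w \<in> fvec p \<Longrightarrow>
    \<alpha> (\<lambda>j. v j + w j) \<approx> \<alpha> v @ \<alpha> w"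
  unfolding splits_cycles_def by simp

lemma splits_cycles_alpha_act:
  "splits_cycles s B p Z \<alpha> k \<Longrightarrow> v \<in> fvec p \<Longrightarrow> \<alpha> (act a v) \<approx> embed_act a (\<alpha> v)"
  unfolding splits_cycles_def by simp

lemma splits_cycles_alpha_zero:
  assumes "splits_cycles s B p Z \<alpha> k"
  shows "\<alpha> (\<lambda>j. 0) \<approx> []"
  using splits_cycles_alpha_add[OF assms fvec_zero fvec_zero] by (simp add: tensor_eq_idem_Nil)

lemma splits_cycles_alpha_comb:
  assumes "splits_cycles s B p Z \<alpha> k" and "\<And>j. j < t \<Longrightarrow> c j \<in> fvec p"
  shows "\<alpha> (comb t w c) \<approx> tcomb t w (\<lambda>j. \<alpha> (c j))"
  using assms(2)
proof (induction t)
  case 0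
  then show ?case using splits_cycles_alpha_zero[OF assms(1)] by (simp add: comb_0 tcomb_0)
next
  case (Suc t)
  have "comb t w c \<in> fvec p" "c t \<in> fvec p" "act (w t) (c t) \<in> fvec p"
    using Suc.prems by (auto intro: comb_in_fvec fvec_act)
  then have "\<alpha> (comb (Suc t) w c) \<approx> \<alpha> (comb t w c) @ \<alpha> (act (w t) (c t))"
    and "\<alpha> (act (w t) (c t)) \<approx> embed_act (w t) (\<alpha> (c t))"
    using splits_cycles_alpha_add[OF assms(1)] splits_cycles_alpha_act[OF assms(1)]
    by (simp_all add: comb_Suc)
  then show ?case
    using Suc unfolding tcomb_Suc by (meson te_app te_trans less_SucI)
qed

text \<open>The last hypothesis says that \<open>B\<close> is the image of \<open>d\<close>. In the
  new module of rank \<open>t + p\<close>, the first \<open>t\<close> coordinates carry the base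
  change of \<open>d\<close> and the last \<open>p\<close> carry \<open>k\<close>. The conclusion
  has the shape of the first hypothesis, so the step can be iterated.\<close>

lemma splits_cycles_step:
  assumes inv: "splits_cycles s B p Z \<alpha> k" and d: "bhom \<phi> t s d"
    and B: "\<And>xs. xs \<in> bvec s \<Longrightarrow> xs \<in> B \<longleftrightarrow> (\<exists>ys\<in>bvec t. d ys \<approx> xs)"
  obtains D \<alpha>' k' where
    "lin_map act (t + p) p D"
    "\<And>v. v \<in> fvec p \<Longrightarrow> v \<in> Z \<longleftrightarrow> (\<exists>w\<in>fvec (t + p). D w = v)"
    "splits_cycles t {xs \<in> bvec t. d xs \<approx> []} (t + p) {v \<in> fvec (t + p). D v = (\<lambda>j. 0)} \<alpha>' k'"
proof -
  have Z: "Z \<subseteq> fvec p" and Z_add: "\<And>v w. v \<in> Z \<Longrightarrow> w \<in> Z \<Longrightarrow> (\<lambda>j. v j + w j) \<in> Z"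
    and \<alpha>_bvec: "\<And>v. v \<in> fvec p \<Longrightarrow> \<alpha> v \<in> bvec s"
    and k: "lin_map act p p k" and kZ: "\<And>v. v \<in> fvec p \<Longrightarrow> k v \<in> Z"
    and \<alpha>Z: "\<And>z. z \<in> Z \<Longrightarrow> \<alpha> z \<in> B" and \<rho>B: "\<And>xs. xs \<in> B \<Longrightarrow> rhov xs \<in> Z"
    and split: "\<And>z. z \<in> Z \<Longrightarrow> z = (\<lambda>j. rhov (\<alpha> z) j + k z j)"
    using inv unfolding splits_cycles_def by (blast+)
  have d_bvec: "\<And>xs. xs \<in> bvec t \<Longrightarrow> d xs \<in> bvec s"
    using d unfolding bhom_def by blast
  have dB: "d xs \<in> B" if "xs \<in> bvec t" for xs
    using B[OF d_bvec[OF that]] that te_refl by blast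

  define q where "q = t + p"
  define b where "b = (\<lambda>j. rhov (d [(j, 1, 1)]))"
  \<comment> \<open>Projection to and inclusion of the second summand, which occupies the
    coordinates from \<open>t\<close> to \<open>t + p - 1\<close>.\<close>
  define snd_part :: "(nat \<Rightarrow> 'a) \<Rightarrow> nat \<Rightarrow> 'a" where "snd_part = (\<lambda>w j. w (j + t))"
  define incl :: "(nat \<Rightarrow> 'a) \<Rightarrow> nat \<Rightarrow> 'a" where "incl = (\<lambda>y j. if j < t then 0 else y (j - t))"
  define D where "D = (\<lambda>w j. comb t w b j + k (snd_part w) j)"

  have snd_fvec: "snd_part w \<in> fvec p" if "w \<in> fvec q" for w
    using that by (simp add: snd_part_def fvec_def q_def)
  have incl_fvec: "incl y \<in> fvec q" if "y \<in> fvec p" for y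
    using that by (auto simp: incl_def fvec_def q_def)
  have fvec_tq: "w \<in> fvec q" if "w \<in> fvec t" for w :: "nat \<Rightarrow> 'a"
    using that by (simp add: fvec_def q_def)
  have \<rho>d: "rhov (d xs) = comb t (rhov xs) b" if "xs \<in> bvec t" for xs
    using rhov_bhom[OF d that] by (simp add: b_def)
  \<comment> \<open>Only the entries of \<open>w\<close> below \<open>t\<close> matter:
    \<open>comb t w unitv\<close> is the truncation of \<open>w\<close>, and it is the retraction of
    the list \<open>?xs\<close>, whose image under \<open>d\<close> lies in
    \<open>B\<close>.\<close>
  have comb_b: "comb t w b \<in> Z" for w
  proof -
    let ?xs = "tcomb t w (\<lambda>j. [(j, 1, 1)])"
    have "?xs \<in> bvec t" by (rule tcomb_in_bvec) (rule unit_in_bvec)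
    moreover have "rhov ?xs = comb t w unitv" by (simp add: rhov_tcomb rhov_unit)
    moreover have "comb t (comb t w unitv) b = comb t w b"
      unfolding comb_def unitv_def
      by (intro ext sum.cong refl arg_cong2[where f = mul])
        (simp add: if_distrib[of "mul _"] mul_one mul_zero_right cong: if_cong)
    ultimately show ?thesis using \<rho>B[OF dB] \<rho>d by metis
  qed
  have DZ: "D w \<in> Z" if "w \<in> fvec q" for w
    unfolding D_def by (intro Z_add comb_b kZ snd_fvec that)
  have D_lin: "lin_map act q p D"
    unfolding lin_map_def
  proof (intro conjI ballI allI)
    show "D v \<in> fvec p" if "v \<in> fvec q" for v using DZ Z that by blast
  next
    fix v w :: "nat \<Rightarrow> 'a" assume vw: "v \<in> fvec q" "w \<in> fvec q"
    have "k (\<lambda>j. snd_part v j + snd_part w j) = (\<lambda>j. k (snd_part v) j + k (snd_part w) j)"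
      by (intro lin_map_add[OF k] snd_fvec vw)
    then show "D (\<lambda>j. v j + w j) = (\<lambda>j. D v j + D w j)"
      by (simp add: D_def comb_add snd_part_def algebra_simps)
  next
    fix a and v :: "nat \<Rightarrow> 'a" assume v: "v \<in> fvec q"
    have "k (act a (snd_part v)) = act a (k (snd_part v))"
      by (intro lin_map_act[OF k] snd_fvec v)
    then show "D (act a v) = act a (D v)"
      by (simp add: D_def comb_act snd_part_def mul_add_right)
  qed
  \<comment> \<open>These two facts evaluate \<open>D\<close> on the summands: it is
    \<open>k\<close> on the second, and on the first it makes \<open>rhov\<close> commute with the
    differentials.\<close>
  have D_incl: "D (incl y) = k y" for y
  proof -
    have "comb t (incl y) b = (\<lambda>j. 0)" by (simp add: comb_def incl_def mul_zero_left)
    then show ?thesis by (simp add: D_def snd_part_def incl_def)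
  qed
  have D_\<rho>: "D (rhov xs) = rhov (d xs)" if "xs \<in> bvec t" for xs
  proof -
    have "snd_part (rhov xs) = (\<lambda>j. 0)"
      using rhov_in_fvec[OF that] by (simp add: snd_part_def fvec_def)
    then show ?thesis using \<rho>d[OF that] lin_map_zero[OF k] by (simp add: D_def)
  qed
  have D_add: "D (\<lambda>j. v j + w j) = (\<lambda>j. D v j + D w j)" if "v \<in> fvec q" "w \<in> fvec q" for v w
    using lin_map_add[OF D_lin that] .

  have exact: "v \<in> Z \<longleftrightarrow> (\<exists>w\<in>fvec q. D w = v)" if v: "v \<in> fvec p" for v
  proof
    assume "v \<in> Z"
    \<comment> \<open>The preimage of \<open>v\<close> is the retraction of a lift \<open>ys\<close>
      of \<open>\<alpha> v\<close>, placed in the first summand, plus \<open>v\<close> itself in the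
      second.\<close>
    then obtain ys where ys: "ys \<in> bvec t" "d ys \<approx> \<alpha> v"
      using \<alpha>Z B[OF \<alpha>_bvec[OF v]] by blast
    have fv: "rhov ys \<in> fvec q" "incl v \<in> fvec q"
      using rhov_in_fvec[OF ys(1)] fvec_tq incl_fvec v by blast+
    have "D (\<lambda>j. rhov ys j + incl v j) = (\<lambda>j. rhov (\<alpha> v) j + k v j)"
      using D_add[OF fv] D_\<rho>[OF ys(1)] D_incl rhov_cong[OF ys(2)] by simp
    then show "\<exists>w\<in>fvec q. D w = v"
      using split[OF \<open>v \<in> Z\<close>] fvec_add[OF fv] by metis
  qed (use DZ in blast)

  \<comment> \<open>The chain map is lifted on basis vectors: \<open>D (unitv j)\<close> lies in
    \<open>Z\<close>, so its image under \<open>\<alpha>\<close> lies in \<open>B\<close> and is hit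
    by \<open>d\<close>.\<close>
  have "\<exists>ys. ys \<in> bvec t \<and> d ys \<approx> \<alpha> (D (unitv j))" if "j < q" for j
    using that unitv_in_fvec[OF that] DZ \<alpha>Z B \<alpha>_bvec Z by (meson subsetD)
  then obtain c where c: "\<And>j. j < q \<Longrightarrow> c j \<in> bvec t"
    and dc: "\<And>j. j < q \<Longrightarrow> d (c j) \<approx> \<alpha> (D (unitv j))"
    by metis
  define \<alpha>' where "\<alpha>' = (\<lambda>w. tcomb q w c)"
  define k' where "k' = (\<lambda>w j. w j - rhov (\<alpha>' w) j - incl (D w) j)"

  have \<alpha>'_bvec: "\<alpha>' w \<in> bvec t" for w
    unfolding \<alpha>'_def by (rule tcomb_in_bvec) (rule c)
  have d\<alpha>': "d (\<alpha>' w) \<approx> \<alpha> (D w)" if w: "w \<in> fvec q" for w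
  proof -
    have "D w = comb q w (\<lambda>j. D (unitv j))"
      using lin_map_comb[OF D_lin, of q unitv w] unitv_in_fvec comb_unitv[OF w] by simp
    moreover have "\<alpha> (comb q w (\<lambda>j. D (unitv j))) \<approx> tcomb q w (\<lambda>j. \<alpha> (D (unitv j)))"
      using DZ Z unitv_in_fvec by (intro splits_cycles_alpha_comb[OF inv]) blast
    moreover have "d (\<alpha>' w) \<approx> tcomb q w (\<lambda>j. d (c j))"
      unfolding \<alpha>'_def by (rule bhom_tcomb[OF d c])
    moreover have "tcomb q w (\<lambda>j. d (c j)) \<approx> tcomb q w (\<lambda>j. \<alpha> (D (unitv j)))"
      by (rule tcomb_cong) (rule dc)
    ultimately show ?thesis by (metis te_sym te_trans)
  qed
  have \<rho>\<alpha>'_fvec: "rhov (\<alpha>' w) \<in> fvec q" for w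
    using rhov_in_fvec[OF \<alpha>'_bvec] fvec_tq by blast
  have D_fvec: "D w \<in> fvec p" if "w \<in> fvec q" for w
    using DZ Z that by blast
  have k'_fvec: "k' w \<in> fvec q" if "w \<in> fvec q" for w
    using that \<rho>\<alpha>'_fvec[of w] incl_fvec[OF D_fvec[OF that]] by (simp add: k'_def fvec_def)
  \<comment> \<open>\<open>\<alpha>'\<close> is additive only up to \<open>\<approx>\<close>, but
    \<open>rhov\<close> turns \<open>tcomb\<close> into \<open>comb\<close>, which makes
    \<open>k'\<close> strictly linear.\<close>
  have k'_lin: "lin_map act q q k'"
    unfolding lin_map_def
  proof (intro conjI ballI allI)
    fix v w :: "nat \<Rightarrow> 'a" assume "v \<in> fvec q" "w \<in> fvec q"
    then show "k' (\<lambda>j. v j + w j) = (\<lambda>j. k' v j + k' w j)"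
      by (auto simp: k'_def \<alpha>'_def rhov_tcomb comb_add D_add incl_def)
  next
    fix a and v :: "nat \<Rightarrow> 'a" assume "v \<in> fvec q"
    then have "D (act a v) = act a (D v)" by (rule lin_map_act[OF D_lin])
    then show "k' (act a v) = act a (k' v)"
      by (auto simp: k'_def \<alpha>'_def rhov_tcomb comb_act incl_def mul_minus_right mul_zero_right)
  qed (rule k'_fvec)
  \<comment> \<open>Apply \<open>D\<close> to
    \<open>w = k' w + rhov (\<alpha>' w) + incl (D w)\<close>. The last two terms give
    \<open>rhov (\<alpha> (D w)) + k (D w)\<close>, which is \<open>D w\<close> by the splitting of
    the old cycle \<open>D w\<close>.\<close>
  have Dk': "D (k' w) = (\<lambda>j. 0)" if w: "w \<in> fvec q" for w
  proof -
    have incl: "incl (D w) \<in> fvec q" by (intro incl_fvec D_fvec w)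
    have "w = (\<lambda>j. k' w j + (rhov (\<alpha>' w) j + incl (D w) j))" by (simp add: k'_def)
    then have "D w = (\<lambda>j. D (k' w) j + (D (rhov (\<alpha>' w)) j + D (incl (D w)) j))"
      using D_add k'_fvec[OF w] \<rho>\<alpha>'_fvec incl fvec_add by metis
    moreover have "D (rhov (\<alpha>' w)) = rhov (\<alpha> (D w))"
      using D_\<rho>[OF \<alpha>'_bvec] rhov_cong[OF d\<alpha>'[OF w]] by simp
    ultimately have "D w = (\<lambda>j. D (k' w) j + D w j)"
      using split[OF DZ[OF w]] D_incl by metis
    then show ?thesis by (metis add_cancel_left_left)
  qed

  have "splits_cycles t {xs \<in> bvec t. d xs \<approx> []} q {v \<in> fvec q. D v = (\<lambda>j. 0)} \<alpha>' k'"
    unfolding splits_cycles_def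
  proof (intro conjI ballI allI)
    show "(\<lambda>j. v j + w j) \<in> {v \<in> fvec q. D v = (\<lambda>j. 0)}"
      if "v \<in> {v \<in> fvec q. D v = (\<lambda>j. 0)}" "w \<in> {v \<in> fvec q. D v = (\<lambda>j. 0)}" for v w
      using that D_add fvec_add by auto
    show "\<alpha>' (\<lambda>j. v j + w j) \<approx> \<alpha>' v @ \<alpha>' w" for v w
      unfolding \<alpha>'_def by (rule tcomb_add)
    show "\<alpha>' (act a v) \<approx> embed_act a (\<alpha>' v)" for a v
      unfolding \<alpha>'_def tcomb_act by (rule te_refl)
    show "\<alpha>' z \<in> {xs \<in> bvec t. d xs \<approx> []}" if "z \<in> {v \<in> fvec q. D v = (\<lambda>j. 0)}" for z
      using that d\<alpha>'[of z] splits_cycles_alpha_zero[OF inv] te_trans \<alpha>'_bvec by auto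
    show "rhov xs \<in> {v \<in> fvec q. D v = (\<lambda>j. 0)}" if "xs \<in> {xs \<in> bvec t. d xs \<approx> []}" for xs
      using that D_\<rho> rhov_in_fvec fvec_tq by (auto dest!: rhov_cong simp: rhov_Nil)
    \<comment> \<open>On a cycle the term \<open>incl (D z)\<close> vanishes, so the definition of
      \<open>k'\<close> is the splitting.\<close>
    show "z = (\<lambda>j. rhov (\<alpha>' z) j + k' z j)" if "z \<in> {v \<in> fvec q. D v = (\<lambda>j. 0)}" for z
      using that by (auto simp: k'_def incl_def)
  qed (use \<alpha>'_bvec k'_lin k'_fvec Dk' in auto)
  with D_lin exact show ?thesis using that unfolding q_def by blast
qed

section \<open>The resolution\<close>

text \<open>The step is iterated up to degree \<open>n\<close>, each time enlarging a finite rank by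
  another finite rank. Working with \<open>\<odot>\<close> covers left and right modules at
  once.\<close>

theorem weak_bi_FP_imp_FP_free:
  assumes "weak_bi_FP \<phi> \<epsilon> n"
  shows "FP_free act (\<lambda>a x. \<epsilon> a * x) n"
proof -
  from assms obtain s :: "nat \<Rightarrow> nat" and g :: "(nat \<times> 'a \<times> 'a) list \<Rightarrow> 'k" and d where
      "\<forall>xs\<in>bvec (s 0). \<forall>ys\<in>bvec (s 0). g (xs @ ys) = g xs + g ys"
      "\<forall>a b. \<forall>xs\<in>bvec (s 0). g (bact a b xs) = \<epsilon> a * g xs * \<epsilon> b"
      and g_surj: "g ` bvec (s 0) = UNIV"
      and d: "\<forall>i\<in>{1..n}. bhom \<phi> (s i) (s (i - 1)) (d i)"
      and exact0: "1 \<le> n \<longrightarrow> (\<forall>xs\<in>bvec (s 0). g xs = 0 \<longleftrightarrow> (\<exists>ys\<in>bvec (s 1). d 1 ys \<approx> xs))"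
      and exact: "\<forall>i\<in>{1..<n}. \<forall>xs\<in>bvec (s i). d i xs \<approx> [] \<longleftrightarrow>
                     (\<exists>ys\<in>bvec (s (i + 1)). d (i + 1) ys \<approx> xs)"
    unfolding weak_bi_FP_def by (elim exE conjE) (rule that)
  then have g_app: "\<And>xs ys. xs \<in> bvec (s 0) \<Longrightarrow> ys \<in> bvec (s 0) \<Longrightarrow> g (xs @ ys) = g xs + g ys"
    and g_act: "\<And>a b xs. xs \<in> bvec (s 0) \<Longrightarrow> g (bact a b xs) = \<epsilon> a * g xs * \<epsilon> b"
    by simp_all
  \<comment> \<open>The base change of \<open>g\<close>: the basis vector of index \<open>j\<close>
    goes to \<open>g [(j, 1, 1)]\<close>.\<close>
  define d0 where "d0 = (\<lambda>w. \<Sum>j<s 0. \<epsilon> (w j) * g [(j, 1, 1)])"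
  have d0_add: "d0 (\<lambda>j. v j + w j) = d0 v + d0 w" for v w
    by (simp add: d0_def eps_add distrib_right sum.distrib)
  have d0_act: "d0 (act a v) = \<epsilon> a * d0 v" for a v
    by (simp add: d0_def eps_mul sum_distrib_left mult.assoc)
  \<comment> \<open>\<open>g\<close> factors through \<open>rhov\<close> because the retraction is
    compatible with the augmentations (\<open>eps_rho\<close>).\<close>
  have d0_\<rho>: "d0 (rhov xs) = g xs" if "xs \<in> bvec (s 0)" for xs
    using that
  proof (induction xs)
    case Nil
    have "g [] = 0" using g_app[of "[]" "[]"] Nil_in_bvec[of "s 0"] by simp
    then show ?case by (simp add: d0_def rhov_Nil eps_zero)
  next
    case (Cons x xs)
    obtain i u v where x: "x = (i, u, v)" by (cases x)
    then have i: "i < s 0" and xs: "xs \<in> bvec (s 0)" using Cons.prems by (auto simp: bvec_def)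
    have "d0 (rhov [x]) = (\<Sum>j<s 0. if j = i then \<epsilon> u * \<epsilon> v * g [(i, 1, 1)] else 0)"
      unfolding d0_def by (rule sum.cong) (auto simp: x rhov_def eps_rho eps_zero)
    also have "\<dots> = g (bact u v [(i, 1, 1)])"
      using i by (simp add: g_act unit_in_bvec mult.assoc mult.left_commute mult.commute)
    finally have "d0 (rhov [x]) = g [x]" by (simp add: x bact_def)
    moreover have "g (x # xs) = g [x] + g xs"
      using g_app[OF unit_in_bvec[OF i] xs, of u v] by (simp add: x)
    moreover have "rhov (x # xs) = (\<lambda>j. rhov [x] j + rhov xs j)"
      using rhov_append[of "[x]" xs] by simp
    ultimately show ?case using Cons.IH[OF xs] d0_add by simp
  qed
  have d0_surj: "d0 ` fvec (s 0) = UNIV"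
  proof (rule set_eqI, simp)
    fix x
    obtain xs where "xs \<in> bvec (s 0)" "g xs = x" using g_surj by (metis UNIV_I imageE)
    then show "x \<in> d0 ` fvec (s 0)" by (metis d0_\<rho> rhov_in_fvec image_eqI)
  qed

  \<comment> \<open>The differentials start at index 1, so the cycles in degree 0 are the kernel of
    \<open>g\<close>.\<close>
  define cyc where "cyc = (\<lambda>i. {xs \<in> bvec (s i). if i = 0 then g xs = 0 else d i xs \<approx> []})"
  \<comment> \<open>Sending each basis vector to the generator \<open>[(j, 1, 1)]\<close> makes
    \<open>rhov\<close> after \<open>\<alpha>\<close> the identity, so \<open>k = 0\<close> splits
    the cycles.\<close>
  have base: "\<exists>\<alpha> k. splits_cycles (s 0) (cyc 0) (s 0) {v \<in> fvec (s 0). d0 v = 0} \<alpha> k"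
  proof (intro exI)
    let ?\<alpha> = "\<lambda>w. tcomb (s 0) w (\<lambda>j. [(j, 1, 1)])"
    have \<alpha>_bvec: "?\<alpha> w \<in> bvec (s 0)" for w by (rule tcomb_in_bvec) (rule unit_in_bvec)
    have \<rho>\<alpha>: "rhov (?\<alpha> w) = w" if "w \<in> fvec (s 0)" for w
      using that by (simp add: rhov_tcomb rhov_unit comb_unitv)
    have d0_zero: "d0 (\<lambda>j. 0) = 0" by (simp add: d0_def eps_zero)
    have g\<alpha>: "g (?\<alpha> w) = d0 w" if "w \<in> fvec (s 0)" for w
      using d0_\<rho>[OF \<alpha>_bvec, of w] \<rho>\<alpha>[OF that] by simp
    show "splits_cycles (s 0) (cyc 0) (s 0) {v \<in> fvec (s 0). d0 v = 0} ?\<alpha> (\<lambda>_ _. 0)"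
      unfolding splits_cycles_def
      by (auto simp: cyc_def \<rho>\<alpha> g\<alpha> \<alpha>_bvec d0_zero d0_add d0_\<rho> fvec_zero fvec_add rhov_in_fvec tcomb_add tcomb_act
          te_refl lin_map_def mul_zero_right)
  qed

  \<comment> \<open>A triple holds the rank, the differential and the cycles of one degree. The
    guards \<open>i \<le> n\<close> and \<open>i < n\<close> allow an infinite sequence in which the
    triple is just repeated from degree \<open>n\<close> on.\<close>
  define P where "P = (\<lambda>i (p, D :: (nat \<Rightarrow> 'a) \<Rightarrow> (nat \<Rightarrow> 'a), Z).
    (i = 0 \<longrightarrow> p = s 0 \<and> Z = {v \<in> fvec (s 0). d0 v = 0}) \<and>
    (i \<le> n \<longrightarrow> (\<exists>\<alpha> k. splits_cycles (s i) (cyc i) p Z \<alpha> k)))"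
  define Q where "Q = (\<lambda>i (p, D :: (nat \<Rightarrow> 'a) \<Rightarrow> (nat \<Rightarrow> 'a), Z) (p', D', Z'). i < n \<longrightarrow>
    lin_map act p' p D' \<and> (\<forall>v\<in>fvec p. v \<in> Z \<longleftrightarrow> (\<exists>w\<in>fvec p'. D' w = v)) \<and>
    Z' = {v \<in> fvec p'. D' v = (\<lambda>j. 0)})"
  have "\<exists>f. \<forall>i. P i (f i) \<and> Q i (f i) (f (Suc i))"
  proof (rule dependent_nat_choice)
    show "\<exists>x. P 0 x" using base by (auto simp: P_def)
  next
    fix x i assume Px: "P i x"
    obtain p D Z where x: "x = (p, D, Z)" by (cases x)
    show "\<exists>y. P (Suc i) y \<and> Q i x y"
    proof (cases "i < n")
      case True
      then obtain \<alpha> k where inv: "splits_cycles (s i) (cyc i) p Z \<alpha> k"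
        using Px by (auto simp: P_def x)
      have d_Suc: "bhom \<phi> (s (Suc i)) (s i) (d (Suc i))" using bspec[OF d, of "Suc i"] True by simp
      have cyc: "xs \<in> cyc i \<longleftrightarrow> (\<exists>ys\<in>bvec (s (Suc i)). d (Suc i) ys \<approx> xs)"
        if "xs \<in> bvec (s i)" for xs
        using that True exact0 bspec[OF exact, of i] by (cases "i = 0") (auto simp: cyc_def)
      obtain D' \<alpha>' k' where "lin_map act (s (Suc i) + p) p D'"
        "\<And>v. v \<in> fvec p \<Longrightarrow> v \<in> Z \<longleftrightarrow> (\<exists>w\<in>fvec (s (Suc i) + p). D' w = v)"
        "splits_cycles (s (Suc i)) {xs \<in> bvec (s (Suc i)). d (Suc i) xs \<approx> []} (s (Suc i) + p)
          {v \<in> fvec (s (Suc i) + p). D' v = (\<lambda>j. 0)} \<alpha>' k'"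
        by (rule splits_cycles_step[OF inv d_Suc cyc]) (assumption, rule that)
      then show ?thesis
        by (intro exI[of _ "(s (Suc i) + p, D', {v \<in> fvec (s (Suc i) + p). D' v = (\<lambda>j. 0)})"])
          (auto simp: P_def Q_def x cyc_def)
    next
      case False
      then show ?thesis by (intro exI[of _ x]) (simp add: P_def Q_def x)
    qed
  qed
  then obtain f where f: "\<And>i. P i (f i)" "\<And>i. Q i (f i) (f (Suc i))" by blast
  define p where "p = (\<lambda>i. fst (f i))"
  define D where "D = (\<lambda>i. fst (snd (f i)))"
  define Z where "Z = (\<lambda>i. snd (snd (f i)))"
  have p0: "p 0 = s 0" and Z0: "Z 0 = {v \<in> fvec (s 0). d0 v = 0}"
    using f(1)[of 0] by (auto simp: P_def p_def Z_def split: prod.splits)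
  have D_lin: "lin_map act (p (Suc i)) (p i) (D (Suc i))"
    and D_exact: "\<And>v. v \<in> fvec (p i) \<Longrightarrow> v \<in> Z i \<longleftrightarrow> (\<exists>w\<in>fvec (p (Suc i)). D (Suc i) w = v)"
    and ZSuc: "Z (Suc i) = {v \<in> fvec (p (Suc i)). D (Suc i) v = (\<lambda>j. 0)}" if "i < n" for i
    using f(2)[of i] that by (auto simp: Q_def p_def D_def Z_def split: prod.splits)
  show ?thesis
    unfolding FP_free_def
  proof (intro exI conjI ballI allI impI)
    show "d0 (\<lambda>j. v j + w j) = d0 v + d0 w" for v w by (rule d0_add)
    show "d0 (act a v) = \<epsilon> a * d0 v" for a v by (rule d0_act)
    show "d0 ` fvec (p 0) = UNIV" using d0_surj p0 by simp
    show "lin_map act (p i) (p (i - 1)) (D i)" if "i \<in> {1..n}" for i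
      using D_lin[of "i - 1"] that by (cases i) auto
    show "d0 v = 0 \<longleftrightarrow> (\<exists>w\<in>fvec (p 1). D 1 w = v)" if "1 \<le> n" "v \<in> fvec (p 0)" for v
      using D_exact[of 0 v] that Z0 p0 by simp
    \<comment> \<open>The kernel of \<open>D i\<close> is \<open>Z i\<close> by the step out of
      degree \<open>i - 1\<close>, and \<open>Z i\<close> is the image of \<open>D (i + 1)\<close>
      by the step out of degree \<open>i\<close>.\<close>
    show "D i v = (\<lambda>j. 0) \<longleftrightarrow> (\<exists>w\<in>fvec (p (i + 1)). D (i + 1) w = v)"
      if "i \<in> {1..<n}" "v \<in> fvec (p i)" for i v
      using D_exact[of i v] ZSuc[of "i - 1"] that by (cases i) auto
  qed
qed

end

section \<open>The two instances: left modules and right modules\<close>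

theorem mainTheorem4:
  fixes \<phi> :: "'k::comm_ring_1 \<Rightarrow> 'a::ring_1" and \<epsilon> :: "'a \<Rightarrow> 'k" and n :: nat
  assumes "aug_alg \<phi> \<epsilon>"
    and "weak_bi_FP \<phi> \<epsilon> n"
  shows "left_FP \<epsilon> n \<and> right_FP \<epsilon> n"
proof
  have \<phi>_add: "\<phi> (x + y) = \<phi> x + \<phi> y" and \<phi>_mult: "\<phi> (x * y) = \<phi> x * \<phi> y"
    and \<phi>_one: "\<phi> 1 = 1" and central: "\<phi> x * a = a * \<phi> x"
    and \<epsilon>_add: "\<epsilon> (a + b) = \<epsilon> a + \<epsilon> b" and \<epsilon>_mult: "\<epsilon> (a * b) = \<epsilon> a * \<epsilon> b"
    and \<epsilon>_one: "\<epsilon> 1 = 1" and \<epsilon>_\<phi>: "\<epsilon> (\<phi> x) = x" for x y a b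
    using assms(1) unfolding aug_alg_def by blast+
  note hom = \<phi>_add \<phi>_mult \<phi>_one \<epsilon>_add \<epsilon>_mult \<epsilon>_one \<epsilon>_\<phi>
  have central_left: "a * (\<phi> x * b) = \<phi> x * (a * b)" for a b x
    by (metis central mult.assoc)
  have \<phi>_\<phi>: "\<phi> x * (\<phi> y * a) = \<phi> (x * y) * a" for x y a
    by (simp add: \<phi>_mult mult.assoc)

  interpret left: enveloping_retract \<phi> \<epsilon> "(*)" "\<lambda>u v. \<phi> (\<epsilon> v) * u" "\<lambda>a. a" "\<lambda>_. 1"
  proof
    \<comment> \<open>The second tensor factor multiplies in the opposite order. Its image under
      \<open>\<phi>\<close> after \<open>\<epsilon>\<close> is commutative and central, so the
      collapse is still multiplicative.\<close>
    show "\<phi> (\<epsilon> (v * b)) * (a * u) = \<phi> (\<epsilon> b) * a * (\<phi> (\<epsilon> v) * u)" for a b u v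
      by (simp add: mult.assoc central_left[of a] \<phi>_\<phi> \<epsilon>_mult mult.commute[of "\<epsilon> b"])
    show "\<phi> (\<epsilon> v) * (\<phi> x * u) = \<phi> (\<epsilon> (\<phi> x * v)) * u" for u v x
      by (simp add: \<phi>_\<phi> \<epsilon>_mult \<epsilon>_\<phi> mult.commute)
  qed (rule central | simp add: hom distrib_left distrib_right mult.assoc te_addl; fail
      | simp add: hom mult.commute; fail)+
  show "left_FP \<epsilon> n"
    unfolding left_FP_def by (rule left.weak_bi_FP_imp_FP_free[OF assms(2)])

  \<comment> \<open>Right modules are modules over the opposite ring, embedded by
    \<open>a \<mapsto> 1 \<otimes> a\<close>; here the first tensor factor is collapsed by the
    augmentation.\<close>
  interpret right: enveloping_retract \<phi> \<epsilon> "\<lambda>a b. b * a" "\<lambda>u v. \<phi> (\<epsilon> u) * v" "\<lambda>_. 1" "\<lambda>a. a"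
  proof
    show "\<phi> (\<epsilon> (a * u)) * (v * b) = \<phi> (\<epsilon> u) * v * (\<phi> (\<epsilon> a) * b)" for a b u v
      by (simp add: mult.assoc central_left[of v] \<phi>_\<phi> \<epsilon>_mult mult.commute[of "\<epsilon> u"])
    show "\<phi> (\<epsilon> (\<phi> x * u)) * v = \<phi> (\<epsilon> u) * (\<phi> x * v)" for u v x
      by (simp add: \<phi>_\<phi> \<epsilon>_mult \<epsilon>_\<phi> mult.commute)
  qed (rule central | simp add: hom distrib_left distrib_right mult.assoc te_addr; fail
      | simp add: hom mult.commute; fail)+
  show "right_FP \<epsilon> n"
    using right.weak_bi_FP_imp_FP_free[OF assms(2)]
    unfolding right_FP_def by (simp add: mult.commute)
qed

end
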